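(* For every integer $n\ge 1$, $$\zeta(2n)=\frac{(-1)^{n+1}\pi^{2n}}{2(2^{2n}-1)}\sum_{k=0}^{n-1}\frac{E_{2k}}{(2k)!\,(2(n-k)-1)!},$$ where $\zeta$ is the Riemann zeta function.
   Context: The Euler numbers $E_m$ are defined by $\frac{1}{\cosh t}=\sum_{m=0}^\infty E_m\frac{t^m}{m!}$ for $|t|<\pi/2$ (so $E_0=1$, $E_2=-1$, $E_4=5$, and odd-index Euler numbers vanish). *)

theory Defs
  imports "HOL-Complex_Analysis.Complex_Analysis"
begin

text \<open>
  The Euler numbers are the coefficients of the exponential generating function of \<open>1 / cosh\<close>
  on \<open>\<bar>t\<bar> < \<pi> / 2\<close>; existence and uniqueness are established below.
\<close>
definition euler_number :: "nat \<Rightarrow> real" where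
  "euler_number = (THE E. \<forall>t::real. \<bar>t\<bar> < pi / 2 \<longrightarrow>
      (\<lambda>m. E m * (t ^ m / fact m)) sums (1 / cosh t))"

lemma cosh_nonzero_ball:
  fixes z :: complex
  assumes "z \<in> ball 0 (pi / 2)"
  shows "cosh z \<noteq> 0"
proof
  assume "cosh z = 0"
  then have "cos (\<i> * z) = 0" by (simp add: cosh_conv_cos)
  then obtain n :: int where n: "\<i> * z = of_int n * complex_of_real pi + of_real pi / 2"
    by (auto simp: cos_eq_0)
  then have "\<i> * z = complex_of_real ((of_int n + 1 / 2) * pi)" by (simp add: algebra_simps)
  then have "norm (\<i> * z) = \<bar>(of_int n + 1 / 2) * pi\<bar>" by (metis norm_of_real real_norm_def)
  then have "norm z = \<bar>of_int n + 1 / 2\<bar> * pi" by (simp add: norm_mult abs_mult)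
  moreover have "\<bar>of_int n + 1 / 2 :: real\<bar> \<ge> 1 / 2"
    by (cases "n \<ge> 0") (auto simp: abs_if)
  then have "\<bar>of_int n + 1 / 2 :: real\<bar> * pi \<ge> 1 / 2 * pi"
    by (intro mult_right_mono) auto
  ultimately show False using assms by simp
qed

lemma ex1_euler_number:
  "\<exists>!E :: nat \<Rightarrow> real. \<forall>t::real. \<bar>t\<bar> < pi / 2 \<longrightarrow>
      (\<lambda>m. E m * (t ^ m / fact m)) sums (1 / cosh t)"
proof (rule ex_ex1I)
  define c where "c m = (deriv ^^ m) (\<lambda>z::complex. 1 / cosh z) 0" for m
  have hol: "(\<lambda>z::complex. 1 / cosh z) holomorphic_on ball 0 (pi / 2)"
    unfolding cosh_field_def
    by (intro holomorphic_intros) (simp, metis cosh_field_def cosh_nonzero_ball)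
  have "(\<lambda>m. Re (c m) * (t ^ m / fact m)) sums (1 / cosh t)" if "\<bar>t\<bar> < pi / 2" for t :: real
  proof -
    have "(\<lambda>m. c m / fact m * (of_real t - 0) ^ m) sums (1 / cosh (complex_of_real t))"
      unfolding c_def by (rule holomorphic_power_series[OF hol]) (use that in auto)
    then have "(\<lambda>m. Re (c m / fact m * (of_real t - 0) ^ m)) sums Re (1 / cosh (complex_of_real t))"
      by (rule sums_Re)
    moreover have "Re (c m / fact m * (of_real t - 0) ^ m) = Re (c m) * (t ^ m / fact m)" for m
    proof -
      have "c m / fact m * (of_real t - 0) ^ m = c m * complex_of_real (t ^ m / fact m)"
        by simp
      then show ?thesis by (simp only: times_complex.sel Re_complex_of_real Im_complex_of_real mult_zero_right diff_zero)
    qed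
    moreover have "1 / cosh (complex_of_real t) = complex_of_real (1 / cosh t)"
      by (simp add: cosh_field_def flip: exp_of_real)
    ultimately show ?thesis by (simp only: Re_complex_of_real)
  qed
  then show "\<exists>E :: nat \<Rightarrow> real. \<forall>t::real. \<bar>t\<bar> < pi / 2 \<longrightarrow>
      (\<lambda>m. E m * (t ^ m / fact m)) sums (1 / cosh t)"
    by (intro exI[of _ "\<lambda>m. Re (c m)"]) blast
next
  fix E F :: "nat \<Rightarrow> real"
  assume E: "\<forall>t::real. \<bar>t\<bar> < pi / 2 \<longrightarrow> (\<lambda>m. E m * (t ^ m / fact m)) sums (1 / cosh t)"
    and F: "\<forall>t::real. \<bar>t\<bar> < pi / 2 \<longrightarrow> (\<lambda>m. F m * (t ^ m / fact m)) sums (1 / cosh t)"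
  define a where "a m = (E m - F m) / fact m" for m
  have a0: "(\<lambda>m. a m * t ^ m) sums 0" if "norm t < pi / 2" for t :: real
    using sums_diff[OF E[rule_format, of t] F[rule_format, of t]] that
    by (simp add: a_def algebra_simps diff_divide_distrib)
  have "a m = 0" for m
  proof (rule ccontr)
    assume am: "a m \<noteq> 0"
    have "a 0 = 0"
      using sums_unique2[OF powser_sums_zero[of a] a0[of 0]] by simp
    with am have "m > 0" by (cases m) auto
    show False
    proof (rule powser_0_nonzero[where r = "pi / 2" and a = a and \<xi> = 0 and f = "\<lambda>_. 0" and m = m])
      fix s :: real
      assume "0 < s" and s: "\<And>z::real. z \<in> cball 0 s - {0} \<Longrightarrow> (0::real) \<noteq> 0"
      then show False using s[of s] by simp
    qed (use am \<open>m > 0\<close> a0 in auto)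
  qed
  then show "E = F" by (auto simp: a_def fun_eq_iff)
qed

lemma euler_number_sums:
  "\<bar>t\<bar> < pi / 2 \<Longrightarrow> (\<lambda>m. euler_number m * (t ^ m / fact m)) sums (1 / cosh t)"
  using theI'[OF ex1_euler_number] unfolding euler_number_def by blast

definition dirichlet_zeta_series :: "complex \<Rightarrow> complex" where
  "dirichlet_zeta_series s = (\<Sum>k. 1 / of_nat (Suc k) powr s)"

text \<open>
  The Riemann zeta function: the Dirichlet series where it converges absolutely, and its
  analytic continuation to \<open>\<complex> - {1}\<close> elsewhere. The continuation is unique by the identity theorem;
  the value at the pole \<open>s = 1\<close> is left unspecified.
\<close>
definition riemann_zeta :: "complex \<Rightarrow> complex" where
  "riemann_zeta s =
     (if Re s > 1 then dirichlet_zeta_series s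
      else (SOME f. f holomorphic_on (- {1}) \<and>
              (\<forall>z. Re z > 1 \<longrightarrow> f z = dirichlet_zeta_series z)) s)"

end

theory Submission
  imports Defs
begin

text \<open>
  Both the Euler numbers and the even zeta values appear in the Taylor series of \<open>tanh\<close> at \<open>0\<close>,
  and the formula compares the two descriptions of the coefficient of \<open>t ^ (2 * n - 1)\<close>.

  On one side, \<open>tanh t = (1 / cosh t) * sinh t\<close>, so the coefficients are Cauchy products of
  \<open>E\<^sub>i / i!\<close> with the coefficients of \<open>sinh\<close> (\<open>tanh_power_series_euler\<close>). The coefficients of \<open>sinh\<close>
  vanish at even indices, so for an odd total index only the \<open>E\<^sub>i\<close> with even \<open>i\<close> survive.

  On the other side, the poles of the tangent give the partial fraction expansion
  \<open>\<pi> tan (\<pi> w) = (\<Sum>k. 2 w / ((k + 1/2)\<^sup>2 - w\<^sup>2))\<close> (\<open>tan_partial_fractions\<close>). It is the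
  logarithmic derivative of the reflection formula for the Gamma function, shifted by \<open>1/2\<close>.
  Expanding each term as a geometric series and exchanging the sums yields a power series in \<open>w\<close>
  with coefficients \<open>2 * (\<Sum>k. 1 / (k + 1/2) ^ (2 * n))\<close>, and such a sum is
  \<open>(2 ^ (2 * n) - 1) * \<zeta> (2 * n)\<close>: up to the factor \<open>2 ^ (2 * n)\<close> it is the part of the zeta series
  that runs over the odd integers. Substituting \<open>w = \<i> * t / \<pi>\<close> turns \<open>tan\<close> into \<open>tanh\<close>
  and produces the sign \<open>(-1) ^ (n + 1)\<close> (\<open>tanh_power_series_zeta\<close>).
\<close>

section \<open>Partial fractions of the tangent\<close>

text \<open>
  This is the logarithmic derivative of Euler's reflection formula. Written with the reciprocal
  Gamma function, both sides of that formula are entire, so it holds everywhere and can be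
  differentiated.
\<close>
lemma Digamma_reflection_complex:
  fixes z :: complex
  assumes "z \<notin> \<int>"
  shows "Digamma (1 - z) - Digamma z = of_real pi * cot (of_real pi * z)"
proof -
  have z: "z \<notin> \<int>\<^sub>\<le>\<^sub>0" and z': "1 - z \<notin> \<int>\<^sub>\<le>\<^sub>0"
    using assms nonpos_Ints_subset_Ints Ints_diff[of 1 "1 - z"] by auto
  have "((\<lambda>x. rGamma x * rGamma (1 - x)) has_field_derivative
          rGamma z * rGamma (1 - z) * (Digamma (1 - z) - Digamma z)) (at z)"
    using z z' by (auto intro!: derivative_eq_intros simp: algebra_simps)
  then have "((\<lambda>x. sin (of_real pi * x) / of_real pi) has_field_derivative
          sin (of_real pi * z) / of_real pi * (Digamma (1 - z) - Digamma z)) (at z)"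
    by (simp only: rGamma_reflection_complex)
  moreover have "((\<lambda>x. sin (of_real pi * x) / of_real pi) has_field_derivative
          cos (of_real pi * z)) (at z)"
    by (auto intro!: derivative_eq_intros)
  ultimately have "sin (of_real pi * z) / of_real pi * (Digamma (1 - z) - Digamma z) = cos (of_real pi * z)"
    by (rule DERIV_unique)
  moreover have "sin (of_real pi * z) \<noteq> 0"
    using assms by (auto simp: sin_eq_0)
  ultimately show ?thesis
    by (simp add: cot_def field_simps)
qed

text \<open>
  The series of the digamma function at \<open>1/2 + w\<close> and at \<open>1/2 - w\<close> contain the same
  convergence-producing terms \<open>1 / (k + 1)\<close>, which cancel in the difference; the shift by \<open>1/2\<close>
  turns the cotangent of the reflection formula into a tangent.
\<close>
lemma tan_partial_fractions:
  fixes w :: complex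
  assumes "1/2 + w \<notin> \<int>"
  shows "(\<lambda>k. 2 * w / ((of_nat k + 1/2)\<^sup>2 - w\<^sup>2)) sums (of_real pi * tan (of_real pi * w))"
proof -
  define z where "z = 1/2 + w"
  have z: "z \<notin> \<int>" using assms by (simp add: z_def)
  have z': "1 - z \<notin> \<int>" using z Ints_diff[of 1 "1 - z"] by auto
  have "z \<noteq> 0" "1 - z \<noteq> 0" using z z' by (metis Ints_0)+
  define d where "d x k = inverse (of_nat (Suc k)) - inverse (x + of_nat k)" for x :: complex and k
  have d: "d x sums (Digamma x + euler_mascheroni)" if "x \<noteq> 0" for x
    using summable_Digamma[OF that] by (simp add: Digamma_def d_def[abs_def] sums_iff)
  have "(\<lambda>k. d z k - d (1 - z) k) sums (Digamma z - Digamma (1 - z))"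
    using sums_diff[OF d d, OF \<open>z \<noteq> 0\<close> \<open>1 - z \<noteq> 0\<close>] by simp
  also have "Digamma z - Digamma (1 - z) = - (of_real pi * cot (of_real pi * z))"
    using Digamma_reflection_complex[OF z] by (simp add: algebra_simps)
  also have "\<dots> = of_real pi * tan (of_real pi * w)"
    by (simp add: cot_def tan_def z_def distrib_left sin_add cos_add flip: sin_of_real cos_of_real)
  also have "(\<lambda>k. d z k - d (1 - z) k) = (\<lambda>k. 2 * w / ((of_nat k + 1/2)\<^sup>2 - w\<^sup>2))"
  proof
    fix k :: nat
    have "z + of_nat k \<noteq> 0" "1 - z + of_nat k \<noteq> 0"
      using z z' by (metis Ints_minus Ints_of_nat eq_neg_iff_add_eq_0)+
    then have nz: "of_nat k + 1/2 + w \<noteq> 0" "of_nat k + 1/2 - w \<noteq> 0"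
      by (simp_all add: z_def algebra_simps)
    have "(of_nat k + 1/2)\<^sup>2 - w\<^sup>2 = (of_nat k + 1/2 + w) * (of_nat k + 1/2 - w)"
      by (simp add: power2_eq_square algebra_simps)
    moreover have "d z k - d (1 - z) k
        = inverse (of_nat k + 1/2 - w) - inverse (of_nat k + 1/2 + w)"
      by (simp add: d_def z_def algebra_simps)
    moreover have "inverse (a - w) - inverse (a + w) = 2 * w / ((a + w) * (a - w))"
      if "a + w \<noteq> 0" "a - w \<noteq> 0" for a
      using that by (simp add: divide_simps)
    ultimately show "d z k - d (1 - z) k = 2 * w / ((of_nat k + 1/2)\<^sup>2 - w\<^sup>2)"
      using nz by simp
  qed
  finally show ?thesis .
qed

section \<open>The power series of the tangent\<close>

text \<open>
  The terms of the zeta series over even integers add up to \<open>\<zeta> m / 2 ^ m\<close>, which leaves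
  \<open>(1 - 1 / 2 ^ m) * \<zeta> m\<close> for the odd integers \<open>2 * k + 1 = 2 * (k + 1/2)\<close>.
\<close>
lemma half_integer_power_sums:
  fixes m :: nat
  assumes "m \<ge> 2"
  shows "(\<lambda>k. 1 / (real k + 1/2) ^ m) sums ((2 ^ m - 1) * (\<Sum>k. 1 / real (Suc k) ^ m))"
proof -
  define a where "a k = 1 / real (Suc k) ^ m" for k
  have "summable (\<lambda>k. inverse (real k ^ m))"
    using assms by (rule inverse_power_summable)
  then have "summable a"
    unfolding a_def by (subst (asm) summable_Suc_iff[symmetric]) (simp add: inverse_eq_divide)
  then have a: "a sums suminf a" by (rule summable_sums)
  \<comment> \<open>The term with index \<open>i\<close> belongs to the integer \<open>i + 1\<close>, so even \<open>i\<close> are the odd integers.\<close>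
  have "(\<lambda>k. sum a {k * 2..<k * 2 + 2}) sums suminf a"
    using a by (rule sums_group) simp
  then have "(\<lambda>k. a (2 * k) + a (2 * k + 1)) sums suminf a"
    by (simp add: numeral_2_eq_2 mult.commute)
  moreover have "a (2 * k + 1) = a k / 2 ^ m" for k
    by (simp add: a_def flip: power_mult_distrib)
       (simp add: algebra_simps)
  ultimately have "(\<lambda>k. a (2 * k) + a k / 2 ^ m) sums suminf a" by simp
  from sums_diff[OF this sums_divide[OF a, of "2 ^ m"]]
  have "(\<lambda>k. a (2 * k)) sums (suminf a - suminf a / 2 ^ m)" by simp
  from sums_mult[OF this, of "2 ^ m"]
  have "(\<lambda>k. 2 ^ m * a (2 * k)) sums ((2 ^ m - 1) * suminf a)"
    by (simp add: algebra_simps)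
  also have "(\<lambda>k. 2 ^ m * a (2 * k)) = (\<lambda>k. 1 / (real k + 1/2) ^ m)"
  proof
    fix k
    have "2 ^ m * a (2 * k) = (2 / (2 * real k + 1)) ^ m"
      by (simp add: a_def power_divide add.commute)
    also have "2 / (2 * real k + 1) = 1 / (real k + 1/2)" by (simp add: field_simps)
    finally show "2 ^ m * a (2 * k) = 1 / (real k + 1/2) ^ m" by (simp add: power_divide)
  qed
  finally show ?thesis by (simp add: a_def[abs_def])
qed

lemma partial_fraction_has_sum:
  fixes a w :: "'a :: {real_normed_field, banach}"
  assumes "norm w < norm a"
  shows "((\<lambda>j. 2 * w ^ (2 * j + 1) / a ^ (2 * j + 2)) has_sum (2 * w / (a\<^sup>2 - w\<^sup>2))) UNIV"
proof -
  define q where "q = (w / a)\<^sup>2"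
  have a: "a \<noteq> 0" using assms by auto
  have "norm (w / a) < 1" using assms a by (simp add: norm_divide field_simps)
  then have q: "norm q < 1"
    by (simp add: q_def norm_power abs_square_less_1)
  have "((\<lambda>j. q ^ j) has_sum (1 / (1 - q))) UNIV"
    using geometric_sums[OF q] summable_geometric[of "norm q"] q
    by (intro norm_summable_imp_has_sum) (simp_all add: norm_power)
  then have "((\<lambda>j. 2 * w / a\<^sup>2 * q ^ j) has_sum (2 * w / a\<^sup>2 * (1 / (1 - q)))) UNIV"
    by (rule has_sum_cmult_right)
  also have "(\<lambda>j. 2 * w / a\<^sup>2 * q ^ j) = (\<lambda>j. 2 * w ^ (2 * j + 1) / a ^ (2 * j + 2))"
    by (simp add: q_def power_divide power_add power_mult power_mult_distrib power2_eq_square mult_ac fun_eq_iff)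
  also have "2 * w / a\<^sup>2 * (1 / (1 - q)) = 2 * w / (a\<^sup>2 - w\<^sup>2)"
  proof -
    have "a\<^sup>2 * (1 - q) = a\<^sup>2 - w\<^sup>2" using a by (simp add: q_def field_simps)
    then show ?thesis by (metis divide_divide_eq_left mult.right_neutral times_divide_eq_right)
  qed
  finally show ?thesis .
qed

lemma half_plus_not_Ints:
  fixes w :: complex
  assumes "norm w < 1/2"
  shows "1/2 + w \<notin> \<int>"
proof
  assume "1/2 + w \<in> \<int>"
  then obtain n where "1/2 + w = of_int n" by (auto elim: Ints_cases)
  then have "1/2 + Re w = of_int n"
    by (metis Re_complex_of_real add.commute of_real_of_int_eq plus_complex.sel(1)
        one_complex.sel(1) Re_divide_numeral)
  moreover have "\<bar>Re w\<bar> < 1/2" using abs_Re_le_cmod[of w] assms by linarith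
  ultimately have "0 < real_of_int n" "real_of_int n < 1" by linarith+
  then show False by (metis of_int_0_less_iff of_int_less_1_iff int_one_le_iff_zero_less not_less)
qed

text \<open>
  The geometric expansions of the partial fractions form a double series, and the theorem amounts
  to summing it by columns instead of by rows. It converges absolutely because the norms of its
  terms are the terms of the same double series for the real argument \<open>norm w\<close>, whose row
  sums are the terms of a partial fraction expansion of the tangent again.
\<close>
lemma tan_power_series:
  fixes w :: complex
  assumes "norm w < 1/2"
  shows "(\<lambda>j. 2 * w ^ (2 * j + 1) * of_real ((2 ^ (2 * j + 2) - 1) * (\<Sum>k. 1 / real (Suc k) ^ (2 * j + 2))))
           sums (of_real pi * tan (of_real pi * w))"
proof -
  define a where "a k = of_nat k + (1/2 :: complex)" for k
  define f where "f = (\<lambda>(k, j). 2 * w ^ (2 * j + 1) / a k ^ (2 * j + 2))"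
  have norm_a: "norm (a k) = real k + 1/2" for k
  proof -
    have "a k = of_real (real k + 1/2)" by (simp add: a_def)
    then show ?thesis
      by (metis norm_of_real abs_of_nonneg add_nonneg_nonneg of_nat_0_le_iff
          divide_nonneg_nonneg zero_le_one zero_le_numeral)
  qed
  have less: "norm w < norm (a k)" for k using assms by (simp add: norm_a)
  have rows: "((\<lambda>j. f (k, j)) has_sum (2 * w / ((a k)\<^sup>2 - w\<^sup>2))) UNIV" for k
    unfolding f_def using partial_fraction_has_sum[OF less[of k]] by simp
  have "(\<lambda>p. norm (f p)) summable_on (UNIV \<times> UNIV)"
  proof (rule summable_on_SigmaI)
    fix k :: nat
    show "((\<lambda>j. norm (f (k, j))) has_sum (2 * norm w / ((norm (a k))\<^sup>2 - (norm w)\<^sup>2))) UNIV"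
      using partial_fraction_has_sum[of "norm w" "norm (a k)"] less[of k]
      by (simp add: f_def norm_mult norm_divide norm_power)
  next
    have "summable (\<lambda>k. 2 * of_real (norm w) / ((a k)\<^sup>2 - (of_real (norm w))\<^sup>2))"
      using tan_partial_fractions[of "of_real (norm w)"] half_plus_not_Ints[of "of_real (norm w)"] assms
      by (simp add: a_def sums_iff)
    moreover have "2 * of_real (norm w) / ((a k)\<^sup>2 - (of_real (norm w))\<^sup>2)
        = complex_of_real (2 * norm w / ((norm (a k))\<^sup>2 - (norm w)\<^sup>2))" for k
      by (simp add: norm_a) (simp add: a_def)
    ultimately have "summable (\<lambda>k. complex_of_real (2 * norm w / ((norm (a k))\<^sup>2 - (norm w)\<^sup>2)))"
      by (simp only:)
    then have "summable (\<lambda>k. 2 * norm w / ((norm (a k))\<^sup>2 - (norm w)\<^sup>2))"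
      by (simp only: summable_complex_of_real)
    moreover have "(norm w)\<^sup>2 \<le> (norm (a k))\<^sup>2" for k
      using less[of k] by (intro power_mono) auto
    ultimately show "(\<lambda>k. 2 * norm w / ((norm (a k))\<^sup>2 - (norm w)\<^sup>2)) summable_on UNIV"
      by (subst summable_on_UNIV_nonneg_real_iff) (auto intro!: divide_nonneg_nonneg)
  qed auto
  then have "f summable_on (UNIV \<times> UNIV)" by (rule abs_summable_summable)
  then obtain S where S: "(f has_sum S) (UNIV \<times> UNIV)" by (auto simp: summable_on_def)
  have "((\<lambda>k. 2 * w / ((a k)\<^sup>2 - w\<^sup>2)) has_sum S) UNIV"
    by (rule has_sum_SigmaD[OF S rows])
  then have "(\<lambda>k. 2 * w / ((a k)\<^sup>2 - w\<^sup>2)) sums S" by (rule has_sum_imp_sums)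
  then have S_eq: "S = of_real pi * tan (of_real pi * w)"
    using tan_partial_fractions[OF half_plus_not_Ints[OF assms]]
    by (auto simp: a_def intro: sums_unique2)
  have columns: "((\<lambda>k. f (k, j)) has_sum (2 * w ^ (2 * j + 1) *
      of_real ((2 ^ (2 * j + 2) - 1) * (\<Sum>k. 1 / real (Suc k) ^ (2 * j + 2))))) UNIV" for j
  proof -
    have "((\<lambda>k. 1 / (real k + 1/2) ^ (2 * j + 2)) has_sum
        ((2 ^ (2 * j + 2) - 1) * (\<Sum>k. 1 / real (Suc k) ^ (2 * j + 2)))) UNIV"
      by (intro sums_nonneg_imp_has_sum half_integer_power_sums) auto
    then have "((\<lambda>k. 2 * w ^ (2 * j + 1) * of_real (1 / (real k + 1/2) ^ (2 * j + 2))) has_sum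
        (2 * w ^ (2 * j + 1) * of_real ((2 ^ (2 * j + 2) - 1) * (\<Sum>k. 1 / real (Suc k) ^ (2 * j + 2))))) UNIV"
      by (intro has_sum_cmult_right has_sum_of_real)
    then show ?thesis by (simp add: f_def a_def)
  qed
  have "((\<lambda>(j, k). f (k, j)) has_sum S) (UNIV \<times> UNIV)"
    using S by (subst (asm) has_sum_swap)
  from has_sum_SigmaD[OF this, of "\<lambda>j. 2 * w ^ (2 * j + 1) *
      of_real ((2 ^ (2 * j + 2) - 1) * (\<Sum>k. 1 / real (Suc k) ^ (2 * j + 2)))"] columns
  show ?thesis unfolding S_eq by (intro has_sum_imp_sums) auto
qed

section \<open>The two power series of the hyperbolic tangent\<close>

lemma tanh_power_series_zeta:
  fixes t :: real
  assumes "\<bar>t\<bar> < pi / 2"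
  shows "(\<lambda>m. (if even m then 0 else
           2 * (-1) ^ (m div 2) * (2 ^ (m + 1) - 1) * (\<Sum>k. 1 / real (Suc k) ^ (m + 1)) / pi ^ (m + 1)) * t ^ m)
         sums tanh t" (is "(\<lambda>m. ?c m * t ^ m) sums _")
proof -
  define Z where "Z m = (2 ^ m - 1) * (\<Sum>k. 1 / real (Suc k) ^ m)" for m
  define w where "w = \<i> * of_real (t / pi)"
  have "norm w < 1/2" using assms by (simp add: w_def norm_mult norm_divide field_simps)
  from tan_power_series[OF this]
  have "(\<lambda>j. 2 * w ^ (2 * j + 1) * of_real (Z (2 * j + 2))) sums (of_real pi * tan (of_real pi * w))"
    by (simp add: Z_def)
  moreover have "of_real pi * tan (of_real pi * w) = \<i> * of_real (pi * tanh t)"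
  proof -
    have "of_real pi * w = \<i> * of_real t" by (simp add: w_def)
    moreover have "tanh (complex_of_real t) = of_real (tanh t)"
      by (simp add: tanh_def sinh_field_def cosh_field_def flip: exp_of_real)
    then have "tan (\<i> * of_real t) = \<i> * complex_of_real (tanh t)"
      using tan_conv_tanh[of "\<i> * of_real t"] by simp
    ultimately show ?thesis by simp
  qed
  moreover have "2 * w ^ (2 * j + 1) * of_real (Z (2 * j + 2))
      = \<i> * of_real (2 * (-1) ^ j * Z (2 * j + 2) * (t / pi) ^ (2 * j + 1))" for j
  proof -
    have "\<i> ^ (2 * j + 1) = \<i> * of_real ((-1) ^ j)" by (simp add: power_mult)
    moreover have "w ^ (2 * j + 1) = \<i> ^ (2 * j + 1) * of_real ((t / pi) ^ (2 * j + 1))"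
      unfolding w_def of_real_power by (rule power_mult_distrib)
    ultimately show ?thesis by (simp only: of_real_mult of_real_numeral mult_ac)
  qed
  ultimately have "(\<lambda>j. \<i> * of_real (2 * (-1) ^ j * Z (2 * j + 2) * (t / pi) ^ (2 * j + 1))) sums
      (\<i> * of_real (pi * tanh t))" by simp
  from sums_Im[OF this]
  have "(\<lambda>j. 2 * (-1) ^ j * Z (2 * j + 2) * (t / pi) ^ (2 * j + 1)) sums (pi * tanh t)"
    by (simp only: complex_i_mult_minus Im_i_times Re_complex_of_real)
  from sums_divide[OF this, of pi]
  have "(\<lambda>j. ?c (2 * j + 1) * t ^ (2 * j + 1)) sums tanh t"
    by (simp add: Z_def power_divide field_simps)
  moreover have "m \<in> range (\<lambda>j. 2 * j + 1)" if "odd m" for m :: nat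
    using that by (auto elim: oddE)
  ultimately show ?thesis
    by (subst (asm) sums_mono_reindex[where f = "\<lambda>m. ?c m * t ^ m"])
       (auto simp: strict_mono_def)
qed

lemma tanh_power_series_euler:
  fixes t :: real
  assumes "\<bar>t\<bar> < pi / 2"
  shows "(\<lambda>m. (\<Sum>i\<le>m. euler_number i / fact i * (if even (m - i) then 0 else 1 / fact (m - i))) * t ^ m)
         sums tanh t"
proof -
  define a where "a i = euler_number i / fact i" for i
  define b :: "nat \<Rightarrow> real" where "b i = (if even i then 0 else 1 / fact i)" for i
  have a: "(\<lambda>i. a i * x ^ i) sums (1 / cosh x)" if "\<bar>x\<bar> < pi / 2" for x
    using euler_number_sums[OF that] by (simp add: a_def)
  have b: "(\<lambda>i. b i * x ^ i) sums sinh x" for x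
    using sinh_converges[of x] by (rule sums_cong[THEN iffD1, rotated]) (simp add: b_def divide_inverse)
  \<comment> \<open>A point between \<open>\<bar>t\<bar>\<close> and the radius: convergence there is absolute convergence at \<open>t\<close>.\<close>
  define T where "T = (\<bar>t\<bar> + pi / 2) / 2"
  have T: "\<bar>t\<bar> < \<bar>T\<bar>" "\<bar>T\<bar> < pi / 2" using assms by (simp_all add: T_def)
  have "summable (\<lambda>i. norm (a i * t ^ i))"
    using powser_insidea[of a T t] a[OF T(2)] T(1) by (auto simp: sums_iff)
  moreover have "summable (\<lambda>i. norm (b i * t ^ i))"
    using powser_insidea[of b T t] b[of T] T(1) by (auto simp: sums_iff)
  ultimately have "(\<lambda>m. \<Sum>i\<le>m. (a i * t ^ i) * (b (m - i) * t ^ (m - i))) sums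
      ((\<Sum>i. a i * t ^ i) * (\<Sum>i. b i * t ^ i))"
    by (rule Cauchy_product_sums)
  also have "(\<Sum>i. a i * t ^ i) * (\<Sum>i. b i * t ^ i) = tanh t"
    using a[OF assms] b[of t] by (simp add: sums_iff tanh_def)
  also have "(\<lambda>m. \<Sum>i\<le>m. (a i * t ^ i) * (b (m - i) * t ^ (m - i))) = (\<lambda>m. (\<Sum>i\<le>m. a i * b (m - i)) * t ^ m)"
    by (intro ext, simp add: sum_distrib_right mult.assoc mult.left_commute[of "_ ^ _"] flip: power_add)
  finally show ?thesis by (simp only: a_def b_def)
qed

section \<open>Comparison of coefficients\<close>

lemma powser_coeffs_unique:
  fixes a b :: "nat \<Rightarrow> 'a :: {real_normed_field, banach}"
  assumes "r > 0"
    and "\<And>t. norm t < r \<Longrightarrow> (\<lambda>n. a n * t ^ n) sums f t"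
    and "\<And>t. norm t < r \<Longrightarrow> (\<lambda>n. b n * t ^ n) sums f t"
  shows "a = b"
proof (rule ccontr)
  assume "a \<noteq> b"
  then obtain m where m: "a m \<noteq> b m" by auto
  have *: "(\<lambda>n. (a n - b n) * t ^ n) sums 0" if "norm t < r" for t
    using sums_diff[OF assms(2,3), OF that that] by (simp add: algebra_simps)
  \<comment> \<open>A series with zero constant term and a nonzero higher coefficient has an isolated zero at
    \<open>0\<close>; multiplying the difference of the two series by \<open>t\<close> gives such a series.\<close>
  define c where "c n = (case n of 0 \<Rightarrow> 0 | Suc k \<Rightarrow> a k - b k)" for n
  have "(\<lambda>n. c n * (t - 0) ^ n) sums 0" if "norm (t - 0) < r" for t
    using sums_mult[OF *[of t], of t] that
    using sums_Suc_iff[of "\<lambda>n. c n * t ^ n" 0] by (simp add: c_def algebra_simps)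
  then obtain s where "0 < s" and s: "\<And>z::'a. z \<in> cball 0 s - {0} \<Longrightarrow> (0::'a) \<noteq> 0"
    using powser_0_nonzero[of r 0 c "\<lambda>_. 0" "Suc m"] \<open>r > 0\<close> m by (auto simp: c_def)
  show False using s[of "of_real s"] \<open>0 < s\<close> by auto
qed

lemma riemann_zeta_of_nat:
  assumes "m \<ge> 2"
  shows "riemann_zeta (of_nat m) = of_real (\<Sum>k. 1 / real (Suc k) ^ m)"
proof -
  have "summable (\<lambda>k. 1 / real (Suc k) ^ m)"
    using inverse_power_summable[OF assms, where 'a = real]
    by (subst (asm) summable_Suc_iff[symmetric]) (simp add: inverse_eq_divide)
  then have "of_real (\<Sum>k. 1 / real (Suc k) ^ m) = (\<Sum>k. complex_of_real (1 / real (Suc k) ^ m))"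
    by (rule suminf_of_real)
  also have "\<dots> = (\<Sum>k. 1 / of_nat (Suc k) powr of_nat m)"
    by (simp add: powr_nat' del: of_nat_Suc)
  finally show ?thesis
    using assms by (simp add: riemann_zeta_def dirichlet_zeta_series_def)
qed

text \<open>
  The index \<open>2 * n - 1\<close> is odd, so \<open>2 * n - 1 - i\<close> is odd exactly for even \<open>i = 2 * k\<close>; this is
  why the Euler numbers of odd index drop out of the Cauchy product.
\<close>
lemma sum_odd_difference_reindex:
  fixes f :: "nat \<Rightarrow> real"
  assumes "n \<ge> 1"
  shows "(\<Sum>i\<le>2 * n - 1. f i * (if even (2 * n - 1 - i) then 0 else 1 / fact (2 * n - 1 - i)))
       = (\<Sum>k = 0..n - 1. f (2 * k) / fact (2 * (n - k) - 1))"
proof -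
  have "(\<Sum>i\<le>2 * n - 1. f i * (if even (2 * n - 1 - i) then 0 else 1 / fact (2 * n - 1 - i)))
      = (\<Sum>i\<in>(\<lambda>k. 2 * k) ` {0..n - 1}. f i * (if even (2 * n - 1 - i) then 0 else 1 / fact (2 * n - 1 - i)))"
  proof (intro sum.mono_neutral_right ballI)
    fix i assume i: "i \<in> {..2 * n - 1} - (\<lambda>k. 2 * k) ` {0..n - 1}"
    have "odd i"
    proof
      assume "even i"
      then have "i = 2 * (i div 2)" "i div 2 \<le> n - 1" using i by auto
      then show False using i by (metis DiffE atLeastAtMost_iff imageI le0)
    qed
    then show "f i * (if even (2 * n - 1 - i) then 0 else 1 / fact (2 * n - 1 - i)) = 0"
      using assms i by auto
  qed (use assms in auto)
  also have "\<dots> = (\<Sum>k = 0..n - 1. f (2 * k) / fact (2 * (n - k) - 1))"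
  proof (subst sum.reindex, force simp: inj_on_def, rule sum.cong[OF refl])
    fix k assume "k \<in> {0..n - 1}"
    then have "2 * n - 1 - 2 * k = 2 * (n - k) - 1" "odd (2 * (n - k) - 1)" using assms by auto
    then show "((\<lambda>i. f i * (if even (2 * n - 1 - i) then 0 else 1 / fact (2 * n - 1 - i))) \<circ> (\<lambda>k. 2 * k)) k
        = f (2 * k) / fact (2 * (n - k) - 1)" by simp
  qed
  finally show ?thesis .
qed

theorem corollary1:
  fixes n :: nat
  assumes "n \<ge> 1"
  shows "riemann_zeta (of_nat (2 * n)) =
    complex_of_real ((- 1) ^ (n + 1) * pi ^ (2 * n) / (2 * (2 ^ (2 * n) - 1)) *
      (\<Sum>k = 0..n - 1. euler_number (2 * k) / (fact (2 * k) * fact (2 * (n - k) - 1))))"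
proof -
  define Z where "Z = (\<Sum>k. 1 / real (Suc k) ^ (2 * n))"
  define S where "S = (\<Sum>k = 0..n - 1. euler_number (2 * k) / (fact (2 * k) * fact (2 * (n - k) - 1)))"
  obtain j where n: "n = Suc j" using assms by (cases n) auto
  have "(\<lambda>m. \<Sum>i\<le>m. euler_number i / fact i * (if even (m - i) then 0 else 1 / fact (m - i)))
      = (\<lambda>m. if even m then 0 else
           2 * (-1) ^ (m div 2) * (2 ^ (m + 1) - 1) * (\<Sum>k. 1 / real (Suc k) ^ (m + 1)) / pi ^ (m + 1))"
    by (rule powser_coeffs_unique[where r = "pi / 2" and f = tanh])
       (simp_all only: real_norm_def pi_half_gt_zero tanh_power_series_euler tanh_power_series_zeta)
  from fun_cong[OF this, of "2 * n - 1"]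
  have "S = 2 * (-1) ^ j * (2 ^ (2 * n) - 1) * Z / pi ^ (2 * n)"
    unfolding sum_odd_difference_reindex[OF assms] S_def Z_def by (simp add: n)
  moreover have "(2::real) ^ (2 * n) - 1 \<noteq> 0"
    using assms one_less_power[of "2::real" "2 * n"] by fastforce
  ultimately have "Z = (- 1) ^ (n + 1) * pi ^ (2 * n) / (2 * (2 ^ (2 * n) - 1)) * S"
    by (cases "even j") (simp_all add: n field_simps)
  then show ?thesis
    using riemann_zeta_of_nat[of "2 * n"] assms by (simp add: Z_def S_def)
qed

end
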